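(* Let $H$ be a bounded convex symmetric domain in $\mathbb{R}^2$ that is strictly convex and irreducible (so that $\mathcal{L}(H)$ is an embedded circle inside $X_2$). Then for each non-empty closed subset $Z$ of $\mathcal{L}(H)$ there exists a bounded convex symmetric domain $K\subset\mathbb{R}^2$ with $K\supset H$ such that $\mathcal{L}(K)=Z$.
   Context: A domain in $\mathbb{R}^2$ is a non-empty connected open set; a domain $K$ is symmetric if $K=-K$ (symmetric about the origin). A lattice in $\mathbb{R}^2$ is a set of the form $\Lambda=g\mathbb{Z}^2$ with $g\in\operatorname{GL}_2(\mathbb{R})$; its covolume is $d(\Lambda)=|\det g|$, which is independent of the choice of $g$. The space $X_2$ of all lattices in $\mathbb{R}^2$ is identified with $\operatorname{GL}_2(\mathbb{R})/\operatorname{GL}_2(\mathbb{Z})$ and carries the quotient topology. Let $K$ be a bounded convex symmetric domain in $\mathbb{R}^2$. A lattice $\Lambda$ is $K$-admissible if $\Lambda\cap K=\{0\}$. The critical determinant of $K$ is $\Delta(K)=\inf\{d(\Lambda):\Lambda \text{ is } K\text{-admissible}\}$. A lattice is $K$-critical if it is $K$-admissible and $d(\Lambda)=\Delta(K)$. The critical locus $\mathcal{L}(K)\subset X_2$ is the set of all $K$-critical lattices, with the subspace topology; closed subsets of $\mathcal{L}(H)$ are taken with respect to this topology. A bounded convex symmetric domain $H$ is irreducible if every bounded convex symmetric domain $H'\subsetneq H$ satisfies $\Delta(H')<\Delta(H)$. It is strictly convex if the line joining any two distinct points of $\partial H$ does not intersect $\partial H$ at any other points. *)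

theory Defs
  imports "HOL-Analysis.Analysis"
begin

section \<open>Domains\<close>

definition symmetric_convex_domain :: "(real^2) set \<Rightarrow> bool" where
  "symmetric_convex_domain K \<longleftrightarrow>
     K \<noteq> {} \<and> open K \<and> connected K \<and> bounded K \<and> convex K \<and> uminus ` K = K"

definition strictly_convex :: "(real^2) set \<Rightarrow> bool" where
  "strictly_convex K \<longleftrightarrow>
     (\<forall>x\<in>frontier K. \<forall>y\<in>frontier K. x \<noteq> y \<longrightarrow> affine hull {x, y} \<inter> frontier K = {x, y})"

section \<open>The space of lattices\<close>

definition GL2 :: "(real^2^2) set" where
  "GL2 = {g. invertible g}"

definition lattice_of :: "real^2^2 \<Rightarrow> (real^2) set" where
  "lattice_of g = {g *v z | z. \<forall>i. z $ i \<in> \<int>}"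

definition lattices :: "(real^2) set set" where
  "lattices = lattice_of ` GL2"

definition covolume :: "(real^2) set \<Rightarrow> real" where
  "covolume \<Lambda> = (THE d. \<exists>g\<in>GL2. \<Lambda> = lattice_of g \<and> d = \<bar>det g\<bar>)"

text \<open>The quotient topology induced by \<^term>\<open>lattice_of\<close>, whose fibres on \<^term>\<open>GL2\<close> are the
  cosets of the integral matrices with integral inverse (\<open>lattice_of_eq_iff\<close>).\<close>

definition lattice_topology :: "(real^2) set topology" where
  "lattice_topology =
     topology (\<lambda>U. U \<subseteq> lattices \<and> openin (top_of_set GL2) {g \<in> GL2. lattice_of g \<in> U})"

definition admissible :: "(real^2) set \<Rightarrow> (real^2) set \<Rightarrow> bool" where
  "admissible K \<Lambda> \<longleftrightarrow> \<Lambda> \<in> lattices \<and> \<Lambda> \<inter> K = {0}"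

definition critical_determinant :: "(real^2) set \<Rightarrow> real" where
  "critical_determinant K = Inf {covolume \<Lambda> | \<Lambda>. admissible K \<Lambda>}"

definition critical :: "(real^2) set \<Rightarrow> (real^2) set \<Rightarrow> bool" where
  "critical K \<Lambda> \<longleftrightarrow> admissible K \<Lambda> \<and> covolume \<Lambda> = critical_determinant K"

definition critical_locus :: "(real^2) set \<Rightarrow> (real^2) set set" where
  "critical_locus K = {\<Lambda>. critical K \<Lambda>}"

definition irreducible_domain :: "(real^2) set \<Rightarrow> bool" where
  "irreducible_domain H \<longleftrightarrow> symmetric_convex_domain H \<and>
     (\<forall>H'. symmetric_convex_domain H' \<and> H' \<subset> H \<longrightarrow>
        critical_determinant H' < critical_determinant H)"

section \<open>The definitions above are well-posed\<close>

definition integral_matrix :: "real^2^2 \<Rightarrow> bool" where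
  "integral_matrix u \<longleftrightarrow> (\<forall>i j. u $ i $ j \<in> \<int>)"

lemma matrix_inv_right_left:
  fixes A :: "real^2^2"
  assumes "invertible A"
  shows matrix_inv_right: "A ** matrix_inv A = mat 1" and matrix_inv_left: "matrix_inv A ** A = mat 1"
  using someI_ex[OF assms[unfolded invertible_def]] unfolding matrix_inv_def by auto

lemma integral_matrix_vector:
  assumes "integral_matrix u" "\<forall>i. z $ i \<in> \<int>"
  shows "(u *v z) $ i \<in> \<int>"
  using assms by (auto simp: integral_matrix_def matrix_vector_mult_def)

lemma det_integral_matrix: "integral_matrix u \<Longrightarrow> det u \<in> \<int>"
  by (auto simp: integral_matrix_def det_2)

lemma lattice_of_subset:
  assumes "invertible h" "lattice_of g \<subseteq> lattice_of h"
  shows "integral_matrix (matrix_inv h ** g)"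
  unfolding integral_matrix_def
proof (intro allI)
  fix i j :: 2
  have "\<forall>i. axis j (1::real) $ i \<in> \<int>"
    by (auto simp: axis_def)
  then have "g *v axis j 1 \<in> lattice_of h"
    using assms(2) unfolding lattice_of_def by blast
  then obtain z where z: "g *v axis j 1 = h *v z" "\<forall>i. z $ i \<in> \<int>"
    unfolding lattice_of_def by blast
  have "(matrix_inv h ** g) *v axis j 1 = matrix_inv h *v (h *v z)"
    using z(1) by (metis matrix_vector_mul_assoc)
  also have "\<dots> = z"
    using assms(1) by (simp add: matrix_vector_mul_assoc matrix_inv_left)
  finally have "column j (matrix_inv h ** g) = z"
    by (simp add: matrix_vector_mult_basis)
  then show "(matrix_inv h ** g) $ i $ j \<in> \<int>"
    using z(2) by (metis column_def vec_lambda_beta)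
qed

lemma lattice_of_mult_subset:
  assumes "integral_matrix u"
  shows "lattice_of (h ** u) \<subseteq> lattice_of h"
proof
  fix x assume "x \<in> lattice_of (h ** u)"
  then obtain z where z: "x = (h ** u) *v z" "\<forall>i. z $ i \<in> \<int>"
    unfolding lattice_of_def by blast
  then have "x = h *v (u *v z)"
    by (simp add: matrix_vector_mul_assoc)
  with z(2) assms show "x \<in> lattice_of h"
    unfolding lattice_of_def using integral_matrix_vector by blast
qed

lemma lattice_of_eq_iff:
  assumes "g \<in> GL2" "h \<in> GL2"
  shows "lattice_of g = lattice_of h \<longleftrightarrow>
     (\<exists>u. integral_matrix u \<and> invertible u \<and> integral_matrix (matrix_inv u) \<and> g = h ** u)"
proof
  have inv: "invertible g" "invertible h"
    using assms by (auto simp: GL2_def)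
  assume eq: "lattice_of g = lattice_of h"
  define u where "u = matrix_inv h ** g"
  define v where "v = matrix_inv g ** h"
  have "u ** v = matrix_inv h ** ((g ** matrix_inv g) ** h)"
    by (simp add: u_def v_def matrix_mul_assoc)
  then have uv: "u ** v = mat 1"
    using inv by (simp add: matrix_inv_right matrix_inv_left)
  then have vu: "v ** u = mat 1"
    using matrix_left_right_inverse by blast
  have iu: "invertible u"
    using uv vu unfolding invertible_def by blast
  have "matrix_inv u = matrix_inv u ** (u ** v)"
    by (simp add: uv)
  also have "\<dots> = v"
    using iu by (simp add: matrix_mul_assoc matrix_inv_left)
  finally have "matrix_inv u = v" .
  moreover have "h ** u = g"
    using inv by (simp add: u_def matrix_mul_assoc matrix_inv_right)
  moreover have "integral_matrix u" "integral_matrix v"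
    using eq inv by (auto simp: u_def v_def intro: lattice_of_subset)
  ultimately show "\<exists>u. integral_matrix u \<and> invertible u \<and> integral_matrix (matrix_inv u) \<and> g = h ** u"
    using iu by blast
next
  assume "\<exists>u. integral_matrix u \<and> invertible u \<and> integral_matrix (matrix_inv u) \<and> g = h ** u"
  then obtain u where u: "integral_matrix u" "invertible u" "integral_matrix (matrix_inv u)" "g = h ** u"
    by blast
  have "h = h ** (u ** matrix_inv u)"
    using u(2) by (simp add: matrix_inv_right)
  then have h: "h = g ** matrix_inv u"
    by (simp add: u(4) matrix_mul_assoc)
  show "lattice_of g = lattice_of h"
  proof
    show "lattice_of g \<subseteq> lattice_of h"
      using lattice_of_mult_subset[OF u(1)] unfolding u(4) .
    show "lattice_of h \<subseteq> lattice_of g"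
      using lattice_of_mult_subset[OF u(3)] by (subst h)
  qed
qed

lemma covolume_lattice_of:
  assumes "g \<in> GL2"
  shows "covolume (lattice_of g) = \<bar>det g\<bar>"
  unfolding covolume_def
proof (rule the_equality)
  show "\<exists>h\<in>GL2. lattice_of g = lattice_of h \<and> \<bar>det g\<bar> = \<bar>det h\<bar>"
    using assms by blast
next
  fix d assume "\<exists>h\<in>GL2. lattice_of g = lattice_of h \<and> d = \<bar>det h\<bar>"
  then obtain h where h: "h \<in> GL2" "lattice_of g = lattice_of h" "d = \<bar>det h\<bar>"
    by blast
  then obtain u where u: "integral_matrix u" "invertible u" "integral_matrix (matrix_inv u)" "g = h ** u"
    using lattice_of_eq_iff[OF assms] by blast
  obtain m n :: int where mn: "det u = of_int m" "det (matrix_inv u) = of_int n"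
    using det_integral_matrix u(1,3) by (meson Ints_cases)
  have "det u * det (matrix_inv u) = 1"
    using u(2) by (simp add: matrix_inv_right flip: det_mul)
  then have "real_of_int (m * n) = 1"
    unfolding mn by simp
  then have "m * n = 1"
    by linarith
  then have "m dvd 1"
    by (metis dvd_triv_left)
  then have "\<bar>m\<bar> = 1"
    by simp
  then have "\<bar>det u\<bar> = 1"
    using mn by linarith
  then show "d = \<bar>det g\<bar>"
    by (simp add: h(3) u(4) det_mul abs_mult)
qed

lemma openin_lattice_topology:
  "openin lattice_topology U \<longleftrightarrow>
     U \<subseteq> lattices \<and> openin (top_of_set GL2) {g \<in> GL2. lattice_of g \<in> U}"
proof -
  have "istopology (\<lambda>U. U \<subseteq> lattices \<and> openin (top_of_set GL2) {g \<in> GL2. lattice_of g \<in> U})"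
    unfolding istopology_def
  proof (intro conjI allI impI)
    fix S T
    assume "S \<subseteq> lattices \<and> openin (top_of_set GL2) {g \<in> GL2. lattice_of g \<in> S}"
      and "T \<subseteq> lattices \<and> openin (top_of_set GL2) {g \<in> GL2. lattice_of g \<in> T}"
    moreover have "{g \<in> GL2. lattice_of g \<in> S \<inter> T} =
        {g \<in> GL2. lattice_of g \<in> S} \<inter> {g \<in> GL2. lattice_of g \<in> T}"
      by blast
    ultimately show "S \<inter> T \<subseteq> lattices"
      "openin (top_of_set GL2) {g \<in> GL2. lattice_of g \<in> S \<inter> T}"
      by (auto intro: openin_Int)
  next
    fix \<K>
    assume *: "\<forall>U\<in>\<K>. U \<subseteq> lattices \<and> openin (top_of_set GL2) {g \<in> GL2. lattice_of g \<in> U}"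
    then show "\<Union>\<K> \<subseteq> lattices"
      by blast
    have "{g \<in> GL2. lattice_of g \<in> \<Union>\<K>} = (\<Union>U\<in>\<K>. {g \<in> GL2. lattice_of g \<in> U})"
      by blast
    with * show "openin (top_of_set GL2) {g \<in> GL2. lattice_of g \<in> \<Union>\<K>}"
      by auto
  qed
  then show ?thesis
    unfolding lattice_topology_def by simp
qed

lemma topspace_lattice_topology [simp]: "topspace lattice_topology = lattices"
proof -
  have "{g \<in> GL2. lattice_of g \<in> lattices} = GL2"
    by (auto simp: lattices_def)
  then have "openin lattice_topology lattices"
    by (simp add: openin_lattice_topology)
  then have "lattices \<subseteq> topspace lattice_topology"
    by (rule openin_subset)
  moreover have "topspace lattice_topology \<subseteq> lattices"
    using openin_topspace[of lattice_topology] unfolding openin_lattice_topology by (rule conjunct1)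
  ultimately show ?thesis
    by (rule subset_antisym[rotated])
qed

lemma quotient_map_lattice_of: "quotient_map (top_of_set GL2) lattice_topology lattice_of"
  unfolding quotient_map_def
  by (auto simp: openin_lattice_topology lattices_def)

lemma admissible_exists:
  assumes "symmetric_convex_domain K"
  shows "\<exists>\<Lambda>. admissible K \<Lambda>"
proof -
  from assms obtain B where B: "B > 0" "\<And>x. x \<in> K \<Longrightarrow> norm x < B"
    unfolding symmetric_convex_domain_def by (meson bounded_pos_less)
  obtain x where "x \<in> K" "- x \<in> K" "convex K"
    using assms unfolding symmetric_convex_domain_def by blast
  then have zero: "0 \<in> K"
    using convexD[of K x "- x" "1/2" "1/2"] by simp
  define g :: "real^2^2" where "g = mat B"
  have gz: "g *v z = B *\<^sub>R z" for z
    by (simp add: g_def vec_eq_iff matrix_vector_mult_def mat_def sum_2 forall_2)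
  have "g \<in> GL2"
    using B(1) by (simp add: GL2_def invertible_det_nz det_2 g_def mat_def)
  moreover have "x = 0" if "x \<in> lattice_of g" "x \<in> K" for x
  proof (rule ccontr)
    assume "x \<noteq> 0"
    from that obtain z where z: "x = B *\<^sub>R z" "\<forall>i. z $ i \<in> \<int>"
      unfolding lattice_of_def gz by blast
    with \<open>x \<noteq> 0\<close> obtain i where "z $ i \<noteq> 0"
      by (metis scaleR_eq_0_iff vec_eq_iff zero_index)
    with z(2) have "1 \<le> \<bar>z $ i\<bar>"
      by (simp add: Ints_nonzero_abs_ge1)
    then have "1 \<le> norm z"
      using component_le_norm_cart[of z i] by linarith
    then have "B \<le> norm x"
      using B(1) by (simp add: z(1))
    with B(2) that(2) show False
      by fastforce
  qed
  moreover have "0 \<in> lattice_of g"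
    unfolding lattice_of_def gz by (auto intro!: exI[of _ 0])
  ultimately show ?thesis
    using zero unfolding admissible_def lattices_def by (intro exI[of _ "lattice_of g"]) auto
qed

lemma bdd_below_covolume: "bdd_below {covolume \<Lambda> | \<Lambda>. admissible K \<Lambda>}"
proof (rule bdd_belowI)
  fix d assume "d \<in> {covolume \<Lambda> | \<Lambda>. admissible K \<Lambda>}"
  then obtain g where "g \<in> GL2" "d = covolume (lattice_of g)"
    unfolding admissible_def lattices_def by blast
  then show "0 \<le> d"
    by (simp add: covolume_lattice_of)
qed

end

theory Submission
  imports Defs
begin

text \<open>The key observation is that a strictly convex domain \<open>H\<close> has at most one critical lattice
  through any given point \<open>p\<close> of its frontier. Indeed \<open>p\<close> is a vertex of a unique inscribed
  affinely regular hexagon \<open>\<plusminus>p, \<plusminus>q, \<plusminus>(q - p)\<close>, up to the choice of a side of the line through \<open>p\<close>,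
  because the chords of \<open>H\<close> parallel to \<open>p\<close> shrink as they move away from the origin; the vertices
  of the hexagon span an admissible lattice, and comparing covolumes shows that a critical lattice
  through \<open>p\<close> must be this one (\<open>critical_lattice_through_frontier_point\<close>). Moreover every critical
  lattice meets the frontier, since otherwise it could be shrunk
  (\<open>critical_lattice_meets_frontier\<close>).

  Now let \<open>Q\<close> be the set of non-zero points of all lattices in \<open>Z\<close>. It is symmetric and disjoint
  from \<open>H\<close>, and it is closed because the lattices in \<open>Z\<close> have bases that form a compact set
  (\<open>closed_set_of_critical_lattices_compact\<close>, \<open>closed_Union_int_span\<close>). Strict convexity allows
  \<open>H\<close> to be enlarged to a domain \<open>K\<close> that still avoids \<open>Q\<close> but contains every other point of the
  frontier of \<open>H\<close> (\<open>enlarge_strictly_convex_domain\<close>).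

  The lattices in \<open>Z\<close> remain admissible for \<open>K\<close>, and a \<open>K\<close>-admissible lattice is
  \<open>H\<close>-admissible. Hence \<open>K\<close> and \<open>H\<close> have the same critical determinant, and the critical lattices
  of \<open>K\<close> are the critical lattices of \<open>H\<close> that avoid \<open>K\<close> except at the origin. Such a lattice has
  a frontier point \<open>p\<close> of \<open>H\<close>, which lies outside \<open>K\<close> and so in \<open>Q\<close>; it therefore shares \<open>p\<close>
  with a lattice of \<open>Z\<close>, and by uniqueness it equals that lattice.\<close>

section \<open>Lattices by bases\<close>

definition cross2 :: "real^2 \<Rightarrow> real^2 \<Rightarrow> real" where
  "cross2 p q = p $ 1 * q $ 2 - p $ 2 * q $ 1"

definition int_span :: "real^2 \<Rightarrow> real^2 \<Rightarrow> (real^2) set" where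
  "int_span p q = {of_int m *\<^sub>R p + of_int n *\<^sub>R q | m n. True}"

definition basis_matrix :: "(real^2) \<times> (real^2) \<Rightarrow> real^2^2" where
  "basis_matrix = (\<lambda>(p, q). \<chi> i j. if j = 1 then p $ i else q $ i)"

lemma cross2_add_right: "cross2 p (x + y) = cross2 p x + cross2 p y"
  and cross2_diff_right: "cross2 p (x - y) = cross2 p x - cross2 p y"
  and cross2_scaleR_right: "cross2 p (a *\<^sub>R x) = a * cross2 p x"
  and cross2_add_left: "cross2 (x + y) p = cross2 x p + cross2 y p"
  and cross2_scaleR_left: "cross2 (a *\<^sub>R x) p = a * cross2 x p"
  and cross2_self: "cross2 p p = 0"
  by (simp_all add: cross2_def algebra_simps)

lemmas cross2_simps = cross2_add_right cross2_diff_right cross2_scaleR_right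
  cross2_add_left cross2_scaleR_left cross2_self

lemma cross2_zero [simp]: "cross2 p 0 = 0" "cross2 0 p = 0"
  by (simp_all add: cross2_def)

lemma continuous_on_cross2:
  assumes "continuous_on S f" "continuous_on S g"
  shows "continuous_on S (\<lambda>x. cross2 (f x) (g x))"
  unfolding cross2_def by (intro continuous_intros assms)

lemma continuous_on_cross2_right: "continuous_on S (cross2 p)"
  using continuous_on_cross2[of S "\<lambda>_. p" "\<lambda>x. x"] by simp

text \<open>Cramer's rule, without division.\<close>

lemma cross2_expand: "cross2 p q *\<^sub>R x = cross2 x q *\<^sub>R p + cross2 p x *\<^sub>R q"
  by (simp add: cross2_def vec_eq_iff forall_2 algebra_simps)

lemma cross2_eq_0_parallel:
  assumes "p \<noteq> 0" "cross2 p x = 0"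
  obtains s where "x = s *\<^sub>R p"
proof (cases "p $ 1 = 0")
  case True
  then have "p $ 2 \<noteq> 0"
    using assms(1) by (auto simp: vec_eq_iff forall_2)
  then have "x = (x $ 2 / p $ 2) *\<^sub>R p"
    using assms(2) True by (auto simp: cross2_def vec_eq_iff forall_2)
  then show ?thesis ..
next
  case False
  then have "x = (x $ 1 / p $ 1) *\<^sub>R p"
    using assms(2) by (auto simp: cross2_def vec_eq_iff forall_2 field_simps)
  then show ?thesis ..
qed

lemma exists_cross2_pos:
  assumes "p \<noteq> 0"
  obtains e where "cross2 p e > 0"
proof
  have "p $ 1 \<noteq> 0 \<or> p $ 2 \<noteq> 0"
    using assms by (auto simp: vec_eq_iff forall_2)
  then have "0 < p $ 1 * p $ 1 + p $ 2 * p $ 2"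
    by (simp add: sum_squares_gt_zero_iff)
  then show "cross2 p (vector [- p $ 2, p $ 1]) > 0"
    by (simp add: cross2_def)
qed

lemma int_spanI: "x = of_int m *\<^sub>R p + of_int n *\<^sub>R q \<Longrightarrow> x \<in> int_span p q"
  unfolding int_span_def by blast

lemma mem_int_span_iff:
  assumes "cross2 p q \<noteq> 0"
  shows "x \<in> int_span p q \<longleftrightarrow> cross2 x q / cross2 p q \<in> \<int> \<and> cross2 p x / cross2 p q \<in> \<int>"
proof
  assume "x \<in> int_span p q"
  then obtain m n where "x = of_int m *\<^sub>R p + of_int n *\<^sub>R q"
    unfolding int_span_def by blast
  then show "cross2 x q / cross2 p q \<in> \<int> \<and> cross2 p x / cross2 p q \<in> \<int>"
    using assms by (simp add: cross2_simps)
next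
  assume "cross2 x q / cross2 p q \<in> \<int> \<and> cross2 p x / cross2 p q \<in> \<int>"
  then obtain m n where mn: "cross2 x q / cross2 p q = of_int m" "cross2 p x / cross2 p q = of_int n"
    by (auto elim!: Ints_cases)
  have "x = (1 / cross2 p q) *\<^sub>R (cross2 p q *\<^sub>R x)"
    using assms by simp
  also have "\<dots> = of_int m *\<^sub>R p + of_int n *\<^sub>R q"
    by (subst cross2_expand) (simp add: scaleR_add_right mn)
  finally show "x \<in> int_span p q"
    by (rule int_spanI)
qed

lemma lattice_of_eq_int_span: "lattice_of g = int_span (column 1 g) (column 2 g)"
proof -
  have eq: "g *v z = z $ 1 *\<^sub>R column 1 g + z $ 2 *\<^sub>R column 2 g" for z
    by (simp add: vec_eq_iff matrix_vector_mult_def column_def sum_2 mult.commute)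
  show ?thesis
  proof (intro equalityI subsetI)
    fix x assume "x \<in> lattice_of g"
    then obtain z where z: "x = g *v z" "z $ 1 \<in> \<int>" "z $ 2 \<in> \<int>"
      unfolding lattice_of_def by blast
    obtain m n where "z $ 1 = of_int m" "z $ 2 = of_int n"
      using z(2,3) by (meson Ints_cases)
    then show "x \<in> int_span (column 1 g) (column 2 g)"
      by (intro int_spanI[of _ m _ n]) (simp add: z(1) eq)
  next
    fix x assume "x \<in> int_span (column 1 g) (column 2 g)"
    then obtain m n where "x = of_int m *\<^sub>R column 1 g + of_int n *\<^sub>R column 2 g"
      unfolding int_span_def by blast
    then have "x = g *v vector [of_int m, of_int n]"
      by (simp add: eq)
    moreover have "\<forall>i. (vector [of_int m, of_int n] :: real^2) $ i \<in> \<int>"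
      by (simp add: forall_2)
    ultimately show "x \<in> lattice_of g"
      unfolding lattice_of_def by blast
  qed
qed

lemma det_eq_cross2: "det g = cross2 (column 1 g) (column 2 g)"
  by (simp add: det_2 cross2_def column_def)

lemma basis_matrix_column:
  "column 1 (basis_matrix (p, q)) = p" "column 2 (basis_matrix (p, q)) = q"
  by (simp_all add: basis_matrix_def column_def vec_eq_iff)

lemma lattice_of_basis_matrix: "lattice_of (basis_matrix (p, q)) = int_span p q"
  by (simp add: lattice_of_eq_int_span basis_matrix_column)

lemma basis_matrix_in_GL2: "basis_matrix (p, q) \<in> GL2 \<longleftrightarrow> cross2 p q \<noteq> 0"
  by (simp add: GL2_def invertible_det_nz det_eq_cross2 basis_matrix_column)

lemma int_span_in_lattices: "cross2 p q \<noteq> 0 \<Longrightarrow> int_span p q \<in> lattices"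
  unfolding lattices_def using basis_matrix_in_GL2 lattice_of_basis_matrix by blast

lemma covolume_int_span: "cross2 p q \<noteq> 0 \<Longrightarrow> covolume (int_span p q) = \<bar>cross2 p q\<bar>"
  using covolume_lattice_of[of "basis_matrix (p, q)"]
  by (simp add: basis_matrix_in_GL2 lattice_of_basis_matrix det_eq_cross2 basis_matrix_column)

lemma lattices_int_spanE:
  assumes "\<Lambda> \<in> lattices"
  obtains p q where "cross2 p q \<noteq> 0" "\<Lambda> = int_span p q"
  using assms that unfolding lattices_def
  by (auto simp: GL2_def lattice_of_eq_int_span invertible_det_nz det_eq_cross2)

lemma int_span_unimodular:
  assumes "a * d - b * c = (1::int)"
  shows "int_span (of_int a *\<^sub>R p + of_int b *\<^sub>R q) (of_int c *\<^sub>R p + of_int d *\<^sub>R q) = int_span p q"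
    (is "int_span ?u ?v = _")
proof (intro equalityI subsetI)
  fix x assume "x \<in> int_span ?u ?v"
  then obtain m n where "x = of_int m *\<^sub>R ?u + of_int n *\<^sub>R ?v"
    unfolding int_span_def by blast
  then have "x = of_int (m * a + n * c) *\<^sub>R p + of_int (m * b + n * d) *\<^sub>R q"
    by (simp add: algebra_simps)
  then show "x \<in> int_span p q"
    by (rule int_spanI)
next
  have r: "of_int a * of_int d - of_int b * of_int c = (1::real)"
    using assms by (metis of_int_1 of_int_diff of_int_mult)
  fix x assume "x \<in> int_span p q"
  then obtain m n where x: "x = of_int m *\<^sub>R p + of_int n *\<^sub>R q"
    unfolding int_span_def by blast
  have "of_int (m * d - n * c) *\<^sub>R ?u + of_int (n * a - m * b) *\<^sub>R ?v
      = (of_int a * of_int d - of_int b * of_int c) *\<^sub>R x"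
    by (simp add: x algebra_simps)
  then have "x = of_int (m * d - n * c) *\<^sub>R ?u + of_int (n * a - m * b) *\<^sub>R ?v"
    by (simp add: r)
  then show "x \<in> int_span ?u ?v"
    by (rule int_spanI)
qed

text \<open>The coordinates of \<open>p\<close> in any basis are coprime, since \<open>p\<close> divided by their greatest common
  divisor is a lattice point; so Bezout's identity provides a second row for a unimodular matrix.
  Its sign is chosen to make the basis positively oriented.\<close>

lemma extend_to_basis:
  assumes "\<Lambda> \<in> lattices" "p \<in> \<Lambda>" "p \<noteq> 0"
    and primitive: "\<And>k. (2::nat) \<le> k \<Longrightarrow> (1 / real k) *\<^sub>R p \<notin> \<Lambda>"
  obtains q where "\<Lambda> = int_span p q" "cross2 p q > 0"
proof -
  obtain u v where uv: "cross2 u v \<noteq> 0" "\<Lambda> = int_span u v"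
    using assms(1) by (rule lattices_int_spanE)
  obtain a b where p: "p = of_int a *\<^sub>R u + of_int b *\<^sub>R v"
    using assms(2) unfolding uv(2) int_span_def by blast
  define k where "k = nat (gcd a b)"
  have k: "of_nat k = gcd a b"
    by (simp add: k_def)
  have "a \<noteq> 0 \<or> b \<noteq> 0"
    using \<open>p \<noteq> 0\<close> p by auto
  then have "k \<noteq> 0"
    using k by (metis gcd_eq_0_iff of_nat_0)
  moreover have "\<not> k \<ge> 2"
  proof
    assume "k \<ge> 2"
    obtain a' b' where "a = of_nat k * a'" "b = of_nat k * b'"
      unfolding k by (meson dvdE gcd_dvd1 gcd_dvd2)
    then have "p = real k *\<^sub>R (of_int a' *\<^sub>R u + of_int b' *\<^sub>R v)"
      by (simp add: p scaleR_add_right)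
    then have "(1 / k) *\<^sub>R p = of_int a' *\<^sub>R u + of_int b' *\<^sub>R v"
      using \<open>k \<noteq> 0\<close> by simp
    then show False
      using primitive[OF \<open>k \<ge> 2\<close>] int_spanI unfolding uv(2) by blast
  qed
  ultimately have "gcd a b = 1"
    using k by simp
  then obtain d c' where "d * a + c' * b = 1"
    using bezout_int[of a b] by auto
  then obtain c where cd: "a * d - b * c = 1"
    by (intro that[of "- c'"]) (simp add: algebra_simps)
  define q where "q = of_int c *\<^sub>R u + of_int d *\<^sub>R v"
  have span: "int_span p q = \<Lambda>"
    unfolding p q_def uv(2) by (rule int_span_unimodular[OF cd])
  have "cross2 p q = of_int (a * d - b * c) * cross2 u v"
    by (simp add: p q_def cross2_def algebra_simps)
  then have nz: "cross2 p q \<noteq> 0"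
    using uv(1) by (simp add: cd)
  have "int_span p (- q) = int_span p q"
  proof -
    have "int_span p (- q) \<subseteq> int_span p q" for q
    proof
      fix x assume "x \<in> int_span p (- q)"
      then obtain m n where "x = of_int m *\<^sub>R p + of_int n *\<^sub>R (- q)"
        unfolding int_span_def by blast
      then have "x = of_int m *\<^sub>R p + of_int (- n) *\<^sub>R q"
        by simp
      then show "x \<in> int_span p q"
        by (rule int_spanI)
    qed
    from this[of q] this[of "- q"] show ?thesis
      by simp
  qed
  moreover have "cross2 p (- q) = - cross2 p q"
    by (simp add: cross2_def)
  ultimately show ?thesis
    using span nz that[of q] that[of "- q"] by (cases "cross2 p q > 0") auto
qed

section \<open>Symmetric convex domains\<close>

lemma symmetric_convex_domainD:
  assumes "symmetric_convex_domain H"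
  shows "open H" "bounded H" "convex H" "0 \<in> H" "x \<in> H \<Longrightarrow> - x \<in> H"
    "x \<in> closure H \<Longrightarrow> - x \<in> closure H" "x \<in> frontier H \<longleftrightarrow> x \<in> closure H \<and> x \<notin> H"
proof -
  show "open H" "bounded H" "convex H"
    using assms by (auto simp: symmetric_convex_domain_def)
  have um: "uminus ` H = H"
    using assms by (simp add: symmetric_convex_domain_def)
  show neg: "- x \<in> H" if "x \<in> H" for x
    using um that by blast
  obtain w where "w \<in> H"
    using assms by (auto simp: symmetric_convex_domain_def)
  then show "0 \<in> H"
    using convexD[OF \<open>convex H\<close> _ neg, of w w "1/2" "1/2"] by simp
  show "- x \<in> closure H" if "x \<in> closure H"
    using image_closure_subset[of H uminus "closure H"] that neg closure_subset
    by (force intro: continuous_intros)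
  show "x \<in> frontier H \<longleftrightarrow> x \<in> closure H \<and> x \<notin> H"
    using \<open>open H\<close> by (auto simp: frontier_def interior_open)
qed

lemma frontier_uminus:
  assumes "symmetric_convex_domain H" "x \<in> frontier H"
  shows "- x \<in> frontier H"
  using symmetric_convex_domainD(5-7)[OF assms(1)] assms(2) by (metis minus_minus)

lemma convex_open_combination:
  fixes H :: "(real^2) set"
  assumes "convex H" "open H" "x \<in> H" "y \<in> closure H" "0 < t" "t \<le> 1"
  shows "t *\<^sub>R x + (1 - t) *\<^sub>R y \<in> H"
proof -
  have "y - t *\<^sub>R (y - x) \<in> interior H"
    using assms by (intro mem_interior_closure_convex_shrink) (auto simp: interior_open)
  then show ?thesis
    using assms(2) by (simp add: interior_open algebra_simps)
qed

lemma scale_into_domain: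
  assumes "symmetric_convex_domain H" "y \<in> closure H" "0 \<le> t" "t < 1"
  shows "t *\<^sub>R y \<in> H"
  using convex_open_combination[of H 0 y "1 - t"] symmetric_convex_domainD[OF assms(1)] assms(2-)
  by simp

lemma strictly_convex_open_segment:
  assumes "symmetric_convex_domain H" "strictly_convex H"
    and "x \<in> closure H" "y \<in> closure H" "x \<noteq> y" "0 < t" "t < 1"
  shows "t *\<^sub>R x + (1 - t) *\<^sub>R y \<in> H" (is "?z \<in> H")
proof -
  note H = symmetric_convex_domainD[OF assms(1)]
  consider "x \<in> H" | "y \<in> H" | "x \<in> frontier H" "y \<in> frontier H"
    using H(7) assms(3,4) by blast
  then show ?thesis
  proof cases
    case 1
    then show ?thesis
      using convex_open_combination H(1,3) assms by simp
  next
    case 2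
    then show ?thesis
      using convex_open_combination[of H y x "1 - t"] H(1,3) assms by (simp add: add.commute)
  next
    case 3
    have "?z \<in> closure H"
      using convexD[OF convex_closure[OF H(3)] assms(3,4), of t "1 - t"] assms(6,7) by simp
    moreover have "?z \<notin> frontier H"
    proof
      assume "?z \<in> frontier H"
      moreover have "?z \<in> affine hull {x, y}"
        unfolding affine_hull_2 by (intro CollectI exI[of _ t] exI[of _ "1 - t"]) simp
      ultimately have "?z = x \<or> ?z = y"
        using assms(2) 3 \<open>x \<noteq> y\<close> unfolding strictly_convex_def by blast
      moreover have "?z - x = (1 - t) *\<^sub>R (y - x)" "?z - y = t *\<^sub>R (x - y)"
        by (simp_all add: algebra_simps)
      ultimately show False
        using assms(5-7) by auto
    qed
    ultimately show ?thesis
      using H(7) by blast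
  qed
qed

section \<open>Inscribed hexagons\<close>

text \<open>If \<open>u\<close>, \<open>v\<close> and \<open>v - u\<close> lie on the frontier, then \<open>u\<close> and \<open>v\<close> are consecutive vertices
  of an inscribed hexagon \<open>\<plusminus>u, \<plusminus>v, \<plusminus>(v - u)\<close>. A point \<open>m u + n v\<close> of \<open>H\<close> in the sector
  between them would force the vertex \<open>v\<close> (or \<open>u\<close>, when \<open>n = 0\<close>) into \<open>H\<close>, because that
  vertex is a convex combination of this point, of points in the closure, and of the origin.\<close>

lemma hexagon_sector_avoids:
  fixes m n :: int
  assumes H: "symmetric_convex_domain H"
    and uv: "u \<in> frontier H" "v \<in> frontier H" "v - u \<in> frontier H"
    and mn: "m \<ge> 0" "n \<ge> 0" "m \<noteq> 0 \<or> n \<noteq> 0"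
  shows "of_int m *\<^sub>R u + of_int n *\<^sub>R v \<notin> H" (is "?x \<notin> H")
proof
  note D = symmetric_convex_domainD[OF H]
  assume x: "?x \<in> H"
  show False
  proof (cases "n = 0")
    case True
    then have "(1 / of_int m) *\<^sub>R ?x = u"
      using mn by simp
    moreover have "(1 / of_int m) *\<^sub>R ?x + (1 - 1 / of_int m) *\<^sub>R 0 \<in> H"
      using mn True D(4) x by (intro convex_open_combination D) (auto simp: closure_def)
    ultimately show False
      using uv(1) D(7) by simp
  next
    case False
    define s where "s = real_of_int (m + n)"
    have mn': "real_of_int n \<ge> 1" "real_of_int m \<ge> 0" "s = of_int m + of_int n"
      using mn False by (auto simp: s_def)
    then have s: "s \<ge> 1"
      by linarith
    \<comment> \<open>The weights sum to \<open>(1 + m) / (m + n)\<close>, which is at most 1 since \<open>n\<close> is at least 1.\<close>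
    have v: "v = (1 / s) *\<^sub>R ?x + (of_int m / s) *\<^sub>R (v - u)"
    proof -
      have "s *\<^sub>R v = ?x + of_int m *\<^sub>R (v - u)"
        by (simp add: mn'(3) algebra_simps)
      then have "(1 / s) *\<^sub>R (s *\<^sub>R v) = (1 / s) *\<^sub>R ?x + (of_int m / s) *\<^sub>R (v - u)"
        by (simp only: scaleR_add_right scaleR_scaleR) simp
      then show ?thesis
        using s by simp
    qed
    show False
    proof (cases "s = 1")
      case True
      then have "m = 0" "n = 1"
        using mn False unfolding s_def by linarith+
      then have "?x = v"
        by simp
      then show False
        using x uv(2) D(7) by simp
    next
      case False
      then have s1: "s > 1"
        using s by simp
      have "(of_int m / (s - 1)) *\<^sub>R (v - u) + (1 - of_int m / (s - 1)) *\<^sub>R 0 \<in> closure H"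
        using uv(3) D(4,7) s1 mn' by (intro convexD convex_closure D) (auto simp: closure_def)
      then have "(1 / s) *\<^sub>R ?x + (1 - 1 / s) *\<^sub>R ((of_int m / (s - 1)) *\<^sub>R (v - u)) \<in> H"
        using s x by (intro convex_open_combination D) auto
      moreover have "(1 - 1 / s) * (of_int m / (s - 1)) = of_int m / s"
        using s1 by (simp add: field_simps)
      ultimately show False
        using v uv(2) D(7) by simp
    qed
  qed
qed

text \<open>The six sectors of the hexagon cover the lattice; up to a sign there are three of them,
  spanned by \<open>(p, q)\<close>, \<open>(q, q - p)\<close> and \<open>(q - p, - p)\<close>.\<close>

lemma inscribed_hexagon_admissible:
  assumes H: "symmetric_convex_domain H"
    and pq: "p \<in> frontier H" "q \<in> frontier H" "q - p \<in> frontier H" "cross2 p q \<noteq> 0"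
  shows "admissible H (int_span p q)"
proof -
  note D = symmetric_convex_domainD[OF H]
  have upper: "of_int m *\<^sub>R p + of_int n *\<^sub>R q \<notin> H" if mn: "n \<ge> 0" "m \<noteq> 0 \<or> n \<noteq> 0" for m n :: int
  proof -
    consider "m \<ge> 0" | "m < 0" "m + n \<ge> 0" | "m + n < 0"
      by linarith
    then show ?thesis
    proof cases
      case 1
      then show ?thesis
        using hexagon_sector_avoids[OF H pq(1-3)] mn by blast
    next
      case 2
      have "of_int (m + n) *\<^sub>R q + of_int (- m) *\<^sub>R (q - p) \<notin> H"
        using 2 mn pq frontier_uminus[OF H] by (intro hexagon_sector_avoids[OF H]) auto
      then show ?thesis
        by (simp add: algebra_simps)
    next
      case 3
      have "of_int n *\<^sub>R (q - p) + of_int (- (m + n)) *\<^sub>R (- p) \<notin> H"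
        using 3 mn pq frontier_uminus[OF H] by (intro hexagon_sector_avoids[OF H]) auto
      then show ?thesis
        by (simp add: algebra_simps)
    qed
  qed
  have "x = 0" if x: "x \<in> int_span p q" "x \<in> H" for x
  proof (rule ccontr)
    assume "x \<noteq> 0"
    obtain m n where x': "x = of_int m *\<^sub>R p + of_int n *\<^sub>R q"
      using x(1) unfolding int_span_def by blast
    have nz: "m \<noteq> 0 \<or> n \<noteq> 0"
      using \<open>x \<noteq> 0\<close> x' by auto
    show False
    proof (cases "n \<ge> 0")
      case True
      then show False
        using upper nz x x' by blast
    next
      case False
      have "of_int (- m) *\<^sub>R p + of_int (- n) *\<^sub>R q = - x"
        by (simp add: x')
      then show False
        using upper[of "- n" "- m"] nz False D(5)[OF x(2)] by simp
    qed
  qed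
  moreover have "0 \<in> int_span p q"
    by (rule int_spanI[of _ 0 _ 0]) simp
  ultimately show ?thesis
    using D(4) int_span_in_lattices[OF pq(4)] unfolding admissible_def by blast
qed

text \<open>Here \<open>cross2 p x\<close> is the height of \<open>x\<close> above the line through \<open>p\<close>, scaled by the length of
  \<open>p\<close>. The set \<open>M = H \<inter> (H + p)\<close> of the proof meets the level \<open>h\<close> iff the chord of \<open>H\<close> at
  this level is longer than \<open>p\<close>. A point \<open>q\<close> of maximal height in the closure of \<open>M\<close> thus marks
  the level where the chord is exactly \<open>p\<close>; the last conclusion says that all chords below are
  longer.\<close>

lemma inscribed_hexagon_exists:
  assumes H: "symmetric_convex_domain H" "strictly_convex H"
    and p: "p \<in> frontier H"
  obtains q where "q \<in> frontier H" "q - p \<in> frontier H" "cross2 p q > 0"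
    "\<And>h. 0 \<le> h \<Longrightarrow> h < cross2 p q \<Longrightarrow> \<exists>x\<in>H. x - p \<in> H \<and> cross2 p x = h"
proof -
  note D = symmetric_convex_domainD[OF H(1)]
  define M where "M = H \<inter> (\<lambda>x. x - p) -` H"
  have M_I: "x \<in> H \<Longrightarrow> x - p \<in> H \<Longrightarrow> x \<in> M" for x
    by (simp add: M_def)
  have openM: "open M"
    unfolding M_def using D(1) by (intro open_Int open_vimage continuous_intros)
  have convM: "convex M"
    unfolding convex_def
  proof (intro ballI allI impI)
    fix x y and u v :: real
    assume *: "x \<in> M" "y \<in> M" "0 \<le> u" "0 \<le> v" "u + v = 1"
    have "u *\<^sub>R (x - p) + v *\<^sub>R (y - p) = u *\<^sub>R x + v *\<^sub>R y - p"
      using \<open>u + v = 1\<close> by (simp add: scaleR_diff_right algebra_simps flip: scaleR_add_left)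
    then show "u *\<^sub>R x + v *\<^sub>R y \<in> M"
      using * convexD[OF D(3), of x y u v] convexD[OF D(3), of "x - p" "y - p" u v]
      by (simp add: M_def)
  qed
  have "p \<noteq> 0"
    using p D(4,7) by blast
  then obtain e where e: "cross2 p e > 0"
    by (rule exists_cross2_pos)
  have half: "(1/2) *\<^sub>R p \<in> M"
  proof (rule M_I)
    show "(1/2) *\<^sub>R p \<in> H"
      using scale_into_domain[OF H(1), of p "1/2"] p D(7) by simp
    then have "- ((1/2) *\<^sub>R p) \<in> H"
      by (rule D(5))
    moreover have "- ((1/2) *\<^sub>R p) = (1/2) *\<^sub>R p - p"
      using scaleR_left_distrib[of "1/2" "1/2" p] by (simp add: algebra_simps)
    ultimately show "(1/2) *\<^sub>R p - p \<in> H"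
      by simp
  qed
  have push: "\<exists>t>0. x + t *\<^sub>R d \<in> S" if "open S" "x \<in> S" for x d and S :: "(real^2) set"
  proof -
    have "((\<lambda>t. x + t *\<^sub>R d) \<longlongrightarrow> x + 0 *\<^sub>R d) (at_right 0)"
      by (intro tendsto_intros)
    then have "\<forall>\<^sub>F t in at_right 0. x + t *\<^sub>R d \<in> S"
      using that by (intro topological_tendstoD) auto
    then obtain b where "b > 0" "\<forall>y>0. y < b \<longrightarrow> x + y *\<^sub>R d \<in> S"
      unfolding eventually_at_right_field by blast
    then show ?thesis
      by (intro exI[of _ "b/2"]) simp
  qed
  have "bounded M"
    using D(2) by (rule bounded_subset) (simp add: M_def)
  then have "compact (closure M)"
    by simp
  moreover have "closure M \<noteq> {}"
    using half by auto
  moreover have "continuous_on (closure M) (cross2 p)"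
    by (rule continuous_on_cross2_right)
  ultimately obtain q where q: "q \<in> closure M" "\<And>x. x \<in> closure M \<Longrightarrow> cross2 p x \<le> cross2 p q"
    using continuous_attains_sup[of "closure M" "cross2 p"] by blast
  have below: "cross2 p x < cross2 p q" if x: "x \<in> M" for x
  proof -
    obtain t where t: "t > 0" "x + t *\<^sub>R e \<in> M"
      using push[OF openM x] by blast
    then have "cross2 p (x + t *\<^sub>R e) \<le> cross2 p q"
      using q(2) closure_subset by blast
    moreover have "t * cross2 p e > 0"
      using t(1) e by simp
    ultimately show ?thesis
      by (simp add: cross2_simps)
  qed
  have qH: "q \<in> closure H"
    using q(1) closure_mono[of M H] by (auto simp: M_def)
  have "(\<lambda>x. x - p) ` closure M \<subseteq> closure H"
    by (rule image_closure_subset)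
      (auto intro!: continuous_intros closure_subset[THEN subsetD] simp: M_def)
  then have qpH: "q - p \<in> closure H"
    using q(1) by blast
  \<comment> \<open>If \<open>q\<close> or \<open>q - p\<close> were interior, sliding the chord along \<open>p\<close> would put a point of maximal
    height into the open set \<open>M\<close>, where the height has no maximum.\<close>
  have "q \<notin> H"
  proof
    assume "q \<in> H"
    obtain t where t: "t > 0" "q + t *\<^sub>R p \<in> H"
      using push[OF D(1) \<open>q \<in> H\<close>] by blast
    define s where "s = min t 1"
    have s: "0 < s" "s \<le> 1" "s \<le> t"
      using t by (auto simp: s_def)
    have "(s / t) *\<^sub>R (q + t *\<^sub>R p) + (1 - s / t) *\<^sub>R q \<in> H"
      using s t \<open>q \<in> H\<close> by (intro convexD D) auto
    then have 1: "q + s *\<^sub>R p \<in> H"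
      using t by (simp add: algebra_simps)
    have "s *\<^sub>R q + (1 - s) *\<^sub>R (q - p) \<in> H"
      using s \<open>q \<in> H\<close> qpH by (intro convex_open_combination D)
    then have "q + s *\<^sub>R p - p \<in> H"
      by (simp add: algebra_simps)
    with 1 have "cross2 p (q + s *\<^sub>R p) < cross2 p q"
      by (intro below M_I)
    then show False
      by (simp add: cross2_simps)
  qed
  moreover have "q - p \<notin> H"
  proof
    assume "q - p \<in> H"
    obtain t where t: "t > 0" "q - p + t *\<^sub>R (- p) \<in> H"
      using push[OF D(1) \<open>q - p \<in> H\<close>] by blast
    define s where "s = min t 1"
    have s: "0 < s" "s \<le> 1" "s \<le> t"
      using t by (auto simp: s_def)
    have "(s / t) *\<^sub>R (q - p + t *\<^sub>R (- p)) + (1 - s / t) *\<^sub>R (q - p) \<in> H"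
      using s t \<open>q - p \<in> H\<close> by (intro convexD D) auto
    then have 1: "q - s *\<^sub>R p - p \<in> H"
      using t by (simp add: algebra_simps)
    have "s *\<^sub>R (q - p) + (1 - s) *\<^sub>R q \<in> H"
      using s \<open>q - p \<in> H\<close> qH by (intro convex_open_combination D)
    then have "q - s *\<^sub>R p \<in> H"
      by (simp add: algebra_simps)
    with 1 have "cross2 p (q - s *\<^sub>R p) < cross2 p q"
      by (intro below M_I)
    then show False
      by (simp add: cross2_simps)
  qed
  ultimately have "q \<in> frontier H" "q - p \<in> frontier H"
    using qH qpH D(7) by blast+
  moreover have "cross2 p q > 0"
    using below[OF half] by (simp add: cross2_simps)
  moreover have "\<exists>x\<in>H. x - p \<in> H \<and> cross2 p x = h" if h: "0 \<le> h" "h < cross2 p q" for h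
  proof -
    have "\<exists>x\<in>M. cross2 p x > h"
    proof (rule ccontr)
      assume "\<not> ?thesis"
      then have "M \<subseteq> {x. cross2 p x \<le> h}"
        by (auto simp: not_less)
      moreover have "closed {x. cross2 p x \<le> h}"
        by (intro closed_Collect_le continuous_on_cross2_right continuous_on_const)
      ultimately have "closure M \<subseteq> {x. cross2 p x \<le> h}"
        by (rule closure_minimal)
      then show False
        using q(1) h(2) by auto
    qed
    then obtain x where x: "x \<in> M" "cross2 p x > h"
      by blast
    define t where "t = h / cross2 p x"
    have "t *\<^sub>R x + (1 - t) *\<^sub>R ((1/2) *\<^sub>R p) \<in> M" (is "?z \<in> M")
      using h(1) x half by (intro convexD convM) (auto simp: t_def field_simps)
    moreover have "cross2 p ?z = h"
      using h(1) x(2) by (simp add: cross2_simps t_def)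
    ultimately show ?thesis
      by (auto simp: M_def)
  qed
  ultimately show ?thesis
    using that by blast
qed

section \<open>At most one critical lattice through a frontier point\<close>

lemma critical_determinant_le:
  assumes "admissible K \<Lambda>"
  shows "critical_determinant K \<le> covolume \<Lambda>"
  unfolding critical_determinant_def using assms by (intro cInf_lower bdd_below_covolume) blast

text \<open>Let \<open>r\<close> complete \<open>p\<close> to a basis of a critical lattice, and let \<open>q\<close> come from the inscribed
  hexagon at \<open>p\<close>. If \<open>r\<close> were lower than \<open>q\<close>, the chord at its level would be longer than \<open>p\<close>
  and contain a point of the row \<open>r + \<int> p\<close>; if it were higher, the hexagonal lattice would have
  smaller covolume. So both are at the same level. There the row, whose spacing is \<open>p\<close>, must hit
  the chord from \<open>q - p\<close> to \<open>q\<close>, and by strict convexity it can do so only at the end points.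
  Hence \<open>q\<close> lies on the lattice, and the lattice is determined by \<open>p\<close>.\<close>

lemma critical_lattice_through_frontier_point:
  assumes H: "symmetric_convex_domain H" "strictly_convex H"
    and p: "p \<in> frontier H"
  obtains q where "q \<in> frontier H" "q - p \<in> frontier H" "cross2 p q > 0"
    "\<And>\<Lambda>. critical H \<Lambda> \<Longrightarrow> p \<in> \<Lambda> \<Longrightarrow> \<Lambda> = int_span p q"
proof -
  note D = symmetric_convex_domainD[OF H(1)]
  have "p \<noteq> 0" and pcl: "p \<in> closure H"
    using p D(4,7) by blast+
  obtain q where q: "q \<in> frontier H" "q - p \<in> frontier H" "cross2 p q > 0"
    and level: "\<And>h. 0 \<le> h \<Longrightarrow> h < cross2 p q \<Longrightarrow> \<exists>x\<in>H. x - p \<in> H \<and> cross2 p x = h"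
    using inscribed_hexagon_exists[OF H p] by blast
  have "\<Lambda> = int_span p q" if crit: "critical H \<Lambda>" and "p \<in> \<Lambda>" for \<Lambda>
  proof -
    have \<Lambda>: "\<Lambda> \<in> lattices" "\<Lambda> \<inter> H = {0}"
      using crit by (auto simp: critical_def admissible_def)
    have "(1 / real k) *\<^sub>R p \<notin> \<Lambda>" if "2 \<le> k" for k
    proof -
      have "(1 / real k) *\<^sub>R p \<in> H"
        using that by (intro scale_into_domain[OF H(1) pcl]) auto
      moreover have "(1 / real k) *\<^sub>R p \<noteq> 0"
        using that \<open>p \<noteq> 0\<close> by simp
      ultimately show ?thesis
        using \<Lambda>(2) by blast
    qed
    then obtain r where r: "\<Lambda> = int_span p r" "cross2 p r > 0"
      using extend_to_basis[OF \<Lambda>(1) \<open>p \<in> \<Lambda>\<close> \<open>p \<noteq> 0\<close>] by blast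
    have row: "r + of_int n *\<^sub>R p \<in> \<Lambda>" "r + of_int n *\<^sub>R p \<noteq> 0" for n
    proof -
      show "r + of_int n *\<^sub>R p \<in> \<Lambda>"
        unfolding r(1) by (rule int_spanI[of _ n _ 1]) simp
      have "cross2 p (r + of_int n *\<^sub>R p) > 0"
        using r(2) by (simp add: cross2_simps)
      then show "r + of_int n *\<^sub>R p \<noteq> 0"
        by auto
    qed
    \<comment> \<open>A half-open segment parallel to \<open>p\<close>, of the length of \<open>p\<close> and at the level of \<open>r\<close>,
      contains a point of the row.\<close>
    have eq_row: "\<exists>n s. x - s *\<^sub>R p = r + of_int n *\<^sub>R p \<and> 0 \<le> s \<and> s < 1"
      if x: "cross2 p x = cross2 p r" for x
    proof -
      have "cross2 p (x - r) = 0"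
        using x by (simp add: cross2_simps)
      then obtain s where s: "x - r = s *\<^sub>R p"
        using cross2_eq_0_parallel[OF \<open>p \<noteq> 0\<close>] by blast
      have "x - (s - of_int \<lfloor>s\<rfloor>) *\<^sub>R p = r + of_int \<lfloor>s\<rfloor> *\<^sub>R p"
        using s by (simp add: algebra_simps)
      moreover have "0 \<le> s - of_int \<lfloor>s\<rfloor>" "s - of_int \<lfloor>s\<rfloor> < 1"
        by linarith+
      ultimately show ?thesis
        by blast
    qed
    have "cross2 p q \<le> cross2 p r"
    proof (rule ccontr)
      assume "\<not> ?thesis"
      then obtain x where x: "x \<in> H" "x - p \<in> H" "cross2 p x = cross2 p r"
        using level[of "cross2 p r"] r(2) by auto
      obtain n s where ns: "x - s *\<^sub>R p = r + of_int n *\<^sub>R p" "0 \<le> s" "s < 1"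
        using eq_row[OF x(3)] by blast
      have "(1 - s) *\<^sub>R x + s *\<^sub>R (x - p) \<in> H"
        using ns x by (intro convexD D) auto
      then have "r + of_int n *\<^sub>R p \<in> H"
        using ns(1) by (simp add: algebra_simps)
      then show False
        using row \<Lambda>(2) by blast
    qed
    moreover have "cross2 p r \<le> cross2 p q"
    proof -
      have "admissible H (int_span p q)"
        using q by (intro inscribed_hexagon_admissible[OF H(1) p]) auto
      then have "critical_determinant H \<le> covolume (int_span p q)"
        by (rule critical_determinant_le)
      then have "covolume \<Lambda> \<le> covolume (int_span p q)"
        using crit by (simp add: critical_def)
      then show ?thesis
        using q(3) r(2) by (simp add: r(1) covolume_int_span)
    qed
    ultimately have "cross2 p q = cross2 p r"
      by simp
    then obtain n s where ns: "q - s *\<^sub>R p = r + of_int n *\<^sub>R p" "0 \<le> s" "s < 1"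
      using eq_row by blast
    have "s = 0"
    proof (rule ccontr)
      assume "s \<noteq> 0"
      have "s *\<^sub>R (q - p) + (1 - s) *\<^sub>R q \<in> H"
        using \<open>s \<noteq> 0\<close> ns q D(7) \<open>p \<noteq> 0\<close> by (intro strictly_convex_open_segment[OF H]) auto
      then have "r + of_int n *\<^sub>R p \<in> H"
        using ns(1) by (simp add: algebra_simps)
      then show False
        using row \<Lambda>(2) by blast
    qed
    then have "q = of_int n *\<^sub>R p + of_int 1 *\<^sub>R r"
      using ns(1) by (simp add: algebra_simps)
    then show ?thesis
      using int_span_unimodular[of 1 1 0 n p r] by (simp add: r(1))
  qed
  with q that show ?thesis
    by blast
qed

section \<open>Compactness of the critical locus\<close>

lemma closed_projection:
  fixes c :: "('a::euclidean_space \<times> 'b::euclidean_space) set"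
  assumes "compact S" "closedin (top_of_set (S \<times> UNIV)) c"
  shows "closed (snd ` c)"
  using Starlike.closed_map_snd[OF assms] by simp

text \<open>By Cramer's rule, a point lies on the lattice with basis \<open>p, q\<close> iff its two coordinates,
  which depend continuously on the point and on \<open>(p, q)\<close>, are integers. Thus the union is the
  projection of a closed subset of \<open>C \<times> UNIV\<close> along a compact factor.\<close>

lemma closed_Union_int_span:
  assumes "compact C" and nz: "\<And>p q. (p, q) \<in> C \<Longrightarrow> cross2 p q \<noteq> 0"
  shows "closed (\<Union>(p, q)\<in>C. int_span p q)"
proof -
  define f where "f = (\<lambda>z::((real^2) \<times> (real^2)) \<times> (real^2).
    (cross2 (snd z) (snd (fst z)) / cross2 (fst (fst z)) (snd (fst z)),
     cross2 (fst (fst z)) (snd z) / cross2 (fst (fst z)) (snd (fst z))))"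
  have "continuous_on (C \<times> UNIV) f"
    unfolding f_def
    by (intro continuous_on_Pair continuous_on_divide continuous_on_cross2 continuous_on_fst
        continuous_on_snd continuous_on_id) (use nz in auto)
  then have "closedin (top_of_set (C \<times> UNIV)) (C \<times> UNIV \<inter> f -` (\<int> \<times> \<int>))"
    by (rule continuous_closedin_preimage) (intro closed_Times closed_Ints)
  then have "closed (snd ` (C \<times> UNIV \<inter> f -` (\<int> \<times> \<int>)))"
    by (rule closed_projection[OF assms(1)])
  also have "snd ` (C \<times> UNIV \<inter> f -` (\<int> \<times> \<int>)) = (\<Union>(p, q)\<in>C. int_span p q)"
    using nz by (force simp: f_def mem_int_span_iff image_iff)
  finally show ?thesis .
qed

text \<open>Otherwise the points of \<open>\<Lambda>\<close> outside \<open>H\<close> have a positive distance from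
  \<open>closure H\<close>, and \<open>\<Lambda>\<close> can be shrunk a little without becoming inadmissible, which lowers the
  covolume.\<close>

lemma critical_lattice_meets_frontier:
  assumes H: "symmetric_convex_domain H" and crit: "critical H \<Lambda>"
  shows "\<Lambda> \<inter> frontier H \<noteq> {}"
proof
  assume empty: "\<Lambda> \<inter> frontier H = {}"
  note D = symmetric_convex_domainD[OF H]
  have \<Lambda>: "\<Lambda> \<in> lattices" "\<Lambda> \<inter> H = {0}"
    using crit by (auto simp: critical_def admissible_def)
  obtain u v where uv: "cross2 u v \<noteq> 0" "\<Lambda> = int_span u v"
    using \<Lambda>(1) by (rule lattices_int_spanE)
  have "closed \<Lambda>"
    using closed_Union_int_span[of "{(u, v)}"] uv by simp
  then have "closed (\<Lambda> - H)"
    using D(1) by (rule closed_Diff)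
  moreover have "closure H \<inter> (\<Lambda> - H) = {}"
    using empty D(7) by blast
  moreover have "compact (closure H)"
    using D(2) by simp
  ultimately obtain \<delta> where \<delta>: "\<delta> > 0" "\<And>x y. x \<in> closure H \<Longrightarrow> y \<in> \<Lambda> - H \<Longrightarrow> \<delta> \<le> dist x y"
    by (meson separate_compact_closed)
  obtain R where R: "R > 0" "\<And>x. x \<in> H \<Longrightarrow> norm x < R"
    using D(2) by (meson bounded_pos_less)
  \<comment> \<open>The factor for which a point \<open>y\<close> with \<open>norm (t *\<^sub>R y) < R\<close> moves by less than \<open>\<delta>\<close>.\<close>
  define t where "t = R / (R + \<delta>)"
  have t: "0 < t" "t < 1" "(1 - t) * R = t * \<delta>"
    using R(1) \<delta>(1) by (auto simp: t_def field_simps)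
  have nz: "cross2 (t *\<^sub>R u) (t *\<^sub>R v) \<noteq> 0"
    using t(1) uv(1) by (simp add: cross2_simps)
  have "x = 0" if x: "x \<in> int_span (t *\<^sub>R u) (t *\<^sub>R v)" "x \<in> H" for x
  proof (rule ccontr)
    assume "x \<noteq> 0"
    obtain m n where "x = of_int m *\<^sub>R (t *\<^sub>R u) + of_int n *\<^sub>R (t *\<^sub>R v)"
      using x(1) unfolding int_span_def by blast
    then have x': "x = t *\<^sub>R (of_int m *\<^sub>R u + of_int n *\<^sub>R v)" (is "_ = t *\<^sub>R ?y")
      by (simp add: algebra_simps)
    have "?y \<in> \<Lambda>"
      unfolding uv(2) by (rule int_spanI) simp
    moreover have "?y \<noteq> 0"
      using \<open>x \<noteq> 0\<close> x' by auto
    ultimately have "?y \<in> \<Lambda> - H"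
      using \<Lambda>(2) by blast
    then have "\<delta> \<le> dist x ?y"
      using x(2) \<delta>(2) closure_subset by blast
    also have "\<dots> = (1 - t) * norm ?y"
    proof -
      have "x - ?y = - ((1 - t) *\<^sub>R ?y)"
        by (simp add: x' algebra_simps)
      then have "dist x ?y = \<bar>1 - t\<bar> * norm ?y"
        unfolding dist_norm by (metis norm_minus_cancel norm_scaleR)
      then show ?thesis
        using t by simp
    qed
    finally have "t * \<delta> \<le> (1 - t) * (t * norm ?y)"
      using t(1) by (simp add: mult.left_commute)
    also have "t * norm ?y = norm x"
      using t(1) by (simp add: x')
    also have "(1 - t) * norm x < (1 - t) * R"
      using R(2)[OF x(2)] t(2) by simp
    finally show False
      using t(3) by simp
  qed
  moreover have "0 \<in> int_span (t *\<^sub>R u) (t *\<^sub>R v)"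
    by (rule int_spanI[of _ 0 _ 0]) simp
  ultimately have "admissible H (int_span (t *\<^sub>R u) (t *\<^sub>R v))"
    using D(4) int_span_in_lattices[OF nz] unfolding admissible_def by blast
  then have "critical_determinant H \<le> covolume (int_span (t *\<^sub>R u) (t *\<^sub>R v))"
    by (rule critical_determinant_le)
  then have "covolume \<Lambda> \<le> covolume (int_span (t *\<^sub>R u) (t *\<^sub>R v))"
    using crit by (simp add: critical_def)
  also have "\<dots> = t * t * \<bar>cross2 u v\<bar>"
    using nz t(1) by (simp add: covolume_int_span cross2_simps abs_mult)
  also have "\<dots> < 1 * \<bar>cross2 u v\<bar>"
    using uv(1) t mult_strict_mono[of t 1 t 1] by (intro mult_strict_right_mono) auto
  finally show False
    using uv by (simp add: covolume_int_span)
qed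

text \<open>The critical lattices are exactly the lattices spanned by the pairs in the compact set \<open>B\<close>
  below: a critical lattice meets the frontier, hence comes from an inscribed hexagon, and
  conversely inscribed hexagons span admissible lattices. This takes the place of Mahler's
  compactness theorem. A closed set of critical lattices is then given by a closed subset of
  \<open>B\<close>, since \<open>(p, q) \<mapsto> int_span p q\<close> is continuous into the quotient topology.\<close>

lemma closed_set_of_critical_lattices_compact:
  assumes H: "symmetric_convex_domain H" "strictly_convex H"
    and "critical H \<Lambda>\<^sub>0"
    and Z: "closedin (subtopology lattice_topology (critical_locus H)) Z"
  obtains C where "compact C" "\<And>p q. (p, q) \<in> C \<Longrightarrow> cross2 p q \<noteq> 0"
    "Z = (\<lambda>(p, q). int_span p q) ` C"
proof -
  note D = symmetric_convex_domainD[OF H(1)]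
  define d where "d = critical_determinant H"
  have "d > 0"
    using assms(3) lattices_int_spanE[of \<Lambda>\<^sub>0] covolume_int_span
    unfolding critical_def admissible_def d_def by (metis zero_less_abs_iff)
  define B where "B = (frontier H \<times> frontier H) \<inter> ((\<lambda>z. snd z - fst z) -` frontier H \<inter>
    (\<lambda>z. cross2 (fst z) (snd z)) -` {d})"
  have "closed ((\<lambda>z. snd z - fst z) -` frontier H)"
    by (intro closed_vimage frontier_closed continuous_intros)
  moreover have "closed ((\<lambda>z. cross2 (fst z) (snd z)) -` {d})"
    by (intro closed_vimage closed_singleton continuous_on_cross2 continuous_on_fst
        continuous_on_snd continuous_on_id)
  moreover have "compact (frontier H \<times> frontier H)"
    using D(2) by (intro compact_Times compact_frontier_bounded)
  ultimately have "compact B"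
    unfolding B_def by (intro compact_Int_closed closed_Int)
  have B_iff: "(p, q) \<in> B \<longleftrightarrow> p \<in> frontier H \<and> q \<in> frontier H \<and> q - p \<in> frontier H \<and> cross2 p q = d"
    for p q
    by (auto simp: B_def)
  let ?L = "\<lambda>(p, q). int_span p q"
  have locus: "critical_locus H = ?L ` B"
  proof (intro equalityI subsetI)
    fix \<Lambda> assume "\<Lambda> \<in> critical_locus H"
    then have crit: "critical H \<Lambda>"
      by (simp add: critical_locus_def)
    then obtain p where p: "p \<in> \<Lambda>" "p \<in> frontier H"
      using critical_lattice_meets_frontier[OF H(1)] by blast
    then obtain q where q: "q \<in> frontier H" "q - p \<in> frontier H" "cross2 p q > 0" "\<Lambda> = int_span p q"
      using critical_lattice_through_frontier_point[OF H] crit by metis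
    moreover have "cross2 p q = d"
      using crit q(3) by (simp add: critical_def q(4) d_def covolume_int_span)
    ultimately show "\<Lambda> \<in> ?L ` B"
      using p(2) B_iff by (auto intro!: rev_image_eqI[of "(p, q)"])
  next
    fix \<Lambda> assume "\<Lambda> \<in> ?L ` B"
    then obtain p q where pq: "(p, q) \<in> B" "\<Lambda> = int_span p q"
      by auto
    then have "admissible H \<Lambda>" "covolume \<Lambda> = d"
      using inscribed_hexagon_admissible[OF H(1)] \<open>d > 0\<close> by (auto simp: B_iff covolume_int_span)
    then show "\<Lambda> \<in> critical_locus H"
      by (simp add: critical_locus_def critical_def d_def)
  qed
  have "continuous_map (top_of_set B) (top_of_set GL2) basis_matrix"
    unfolding continuous_map_subtopology_eu
  proof (intro conjI)
    show "continuous_on B basis_matrix"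
      unfolding basis_matrix_def case_prod_unfold
    proof (intro continuous_on_vec_lambda)
      fix i j :: 2
      show "continuous_on B (\<lambda>z. if j = 1 then fst z $ i else snd z $ i)"
        by (cases "j = 1") (auto intro!: continuous_intros)
    qed
    show "basis_matrix \<in> B \<rightarrow> GL2"
      using \<open>d > 0\<close> by (auto simp: basis_matrix_in_GL2 B_iff)
  qed
  then have "continuous_map (top_of_set B) lattice_topology (lattice_of \<circ> basis_matrix)"
    by (rule continuous_map_compose) (rule quotient_imp_continuous_map[OF quotient_map_lattice_of])
  moreover have "lattice_of \<circ> basis_matrix = ?L"
    by (auto simp: lattice_of_basis_matrix)
  ultimately have cont: "continuous_map (top_of_set B) lattice_topology ?L"
    by simp
  obtain T where T: "closedin lattice_topology T" "Z = T \<inter> critical_locus H"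
    using Z unfolding closedin_subtopology by blast
  define C where "C = {z \<in> B. ?L z \<in> T}"
  have "closedin (top_of_set B) C"
    using closedin_continuous_map_preimage[OF cont T(1)] by (simp add: C_def)
  then have "compact C"
    using \<open>compact B\<close> by (rule closedin_compact[rotated])
  moreover have "cross2 p q \<noteq> 0" if "(p, q) \<in> C" for p q
    using that \<open>d > 0\<close> by (auto simp: C_def B_iff)
  moreover have "Z = ?L ` C"
    unfolding T(2) locus C_def by blast
  ultimately show ?thesis
    using that by blast
qed

section \<open>Enlarging a strictly convex domain\<close>

text \<open>The domain \<open>H\<close> is the intersection of the half-planes \<open>f \<bullet> x < 1\<close> over the pairs
  \<open>(y, f)\<close> in \<open>S\<close>: a frontier point \<open>y\<close> with a supporting functional \<open>f\<close>. Each bound is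
  relaxed by a quantity proportional to the distance from \<open>y\<close> to \<open>Q\<close>. On the one hand a point
  \<open>x\<close> of \<open>Q\<close> stays outside: if \<open>y\<close> is the frontier point on the ray from the origin to \<open>x\<close>,
  then \<open>f \<bullet> x - 1\<close> is at least \<open>dist y x / R\<close>, so the relaxation at \<open>y\<close> is too small to
  admit \<open>x\<close>. On the other hand a frontier point \<open>x\<close> outside \<open>Q\<close> is admitted: by strict
  convexity only the constraints with \<open>y = x\<close> are tight at \<open>x\<close>, and those are relaxed.
  Compactness of \<open>S\<close> makes the enlarged domain open.\<close>

lemma enlarge_strictly_convex_domain:
  assumes H: "symmetric_convex_domain H" "strictly_convex H"
    and Q: "closed Q" "Q \<noteq> {}" "\<And>x. x \<in> Q \<Longrightarrow> - x \<in> Q" "Q \<inter> H = {}"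
  obtains K where "symmetric_convex_domain K" "H \<subseteq> K" "K \<inter> Q = {}" "frontier H - Q \<subseteq> K"
proof -
  note D = symmetric_convex_domainD[OF H(1)]
  obtain R where R: "R > 0" "\<And>x. x \<in> closure H \<Longrightarrow> norm x \<le> R"
    using D(2) by (meson bounded_closure bounded_pos)
  have fr: "x \<in> frontier H \<Longrightarrow> x \<in> closure H" for x
    by (simp add: D(7))
  define S where "S = {z. fst z \<in> frontier H \<and> snd z \<bullet> fst z = 1 \<and> (\<forall>x\<in>closure H. snd z \<bullet> x \<le> 1)}"
  have S_iff: "(y, f) \<in> S \<longleftrightarrow> y \<in> frontier H \<and> f \<bullet> y = 1 \<and> (\<forall>x\<in>closure H. f \<bullet> x \<le> 1)" for y f
    by (simp add: S_def)
  have support: "\<exists>f. (y, f) \<in> S" if y: "y \<in> frontier H" for y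
  proof -
    have "y \<notin> H" "y \<in> closure H"
      using y D(7) by blast+
    then obtain a b where a: "a \<noteq> 0" "\<And>x. x \<in> H \<Longrightarrow> a \<bullet> x \<le> b" "b \<le> a \<bullet> y"
      using separating_hyperplane_sets[of H "{y}"] D(3,4) by auto
    obtain e where e: "e > 0" "cball 0 e \<subseteq> H"
      using D(1,4) open_contains_cball by blast
    have "(e / norm a) *\<^sub>R a \<in> H"
      using e a(1) by (intro subsetD[OF e(2)]) simp
    then have "a \<bullet> ((e / norm a) *\<^sub>R a) \<le> b"
      by (rule a(2))
    moreover have "a \<bullet> ((e / norm a) *\<^sub>R a) > 0"
      using e(1) a(1) by simp
    ultimately have "a \<bullet> y > 0"
      using a(3) by linarith
    have "H \<subseteq> {x. a \<bullet> x \<le> a \<bullet> y}"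
      using a(2,3) by force
    then have "closure H \<subseteq> {x. a \<bullet> x \<le> a \<bullet> y}"
      by (intro closure_minimal closed_halfspace_le)
    then have "(y, (1 / (a \<bullet> y)) *\<^sub>R a) \<in> S"
      using y \<open>a \<bullet> y > 0\<close> by (auto simp: S_iff)
    then show ?thesis
      by blast
  qed
  have "compact S"
    unfolding compact_eq_bounded_closed
  proof
    obtain e where e: "e > 0" "cball 0 e \<subseteq> H"
      using D(1,4) open_contains_cball by blast
    have "norm f \<le> 1 / e" if "(y, f) \<in> S" for y f
    proof (cases "f = 0")
      case False
      have "(e / norm f) *\<^sub>R f \<in> closure H"
        using e False by (intro subsetD[OF closure_subset] subsetD[OF e(2)]) simp
      then have "f \<bullet> ((e / norm f) *\<^sub>R f) \<le> 1"
        using that S_iff by blast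
      moreover have "f \<bullet> ((e / norm f) *\<^sub>R f) = e * norm f"
        using False by (simp add: dot_square_norm power2_eq_square)
      ultimately show ?thesis
        using e(1) by (simp add: field_simps)
    qed (use e in simp)
    then have "S \<subseteq> cball 0 R \<times> cball 0 (1 / e)"
      using R(2) fr by (auto simp: S_iff)
    then show "bounded S"
      by (rule bounded_subset[rotated]) (intro bounded_Times bounded_cball)
    have "S = fst -` frontier H \<inter> {z. snd z \<bullet> fst z = 1} \<inter> (\<Inter>x\<in>closure H. {z. snd z \<bullet> x \<le> 1})"
      by (auto simp: S_def)
    moreover have "closed \<dots>"
      by (intro closed_Int closed_INT ballI closed_vimage frontier_closed closed_Collect_eq
          closed_Collect_le continuous_intros)
    ultimately show "closed S"
      by simp
  qed
  define b where "b y = 1 + infdist y Q / R" for y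
  have b_ge: "b y \<ge> 1" for y
    using R(1) infdist_nonneg[of y Q] by (simp add: b_def)
  define K where "K = {x. \<forall>(y, f)\<in>S. f \<bullet> x < b y}"
  \<comment> \<open>The complement is a projection along the compact set \<open>S\<close>.\<close>
  have "closed (- K)"
  proof -
    define E where "E = S \<times> UNIV \<inter> {z. b (fst (fst z)) \<le> snd (fst z) \<bullet> snd z}"
    have "closed {z. b (fst (fst z)) \<le> snd (fst z) \<bullet> (snd z :: real^2)}"
      unfolding b_def by (intro closed_Collect_le continuous_intros) (use R(1) in auto)
    then have "closedin (top_of_set (S \<times> UNIV)) E"
      unfolding E_def by (rule closedin_closed_Int)
    then have "closed (snd ` E)"
      by (rule closed_projection[OF \<open>compact S\<close>])
    also have "snd ` E = - K"
      by (force simp: E_def K_def not_less image_iff)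
    finally show ?thesis .
  qed
  then have "open K"
    by (simp add: open_closed)
  have less_1: "f \<bullet> x < 1" if yf: "(y, f) \<in> S" and x: "x \<in> H" for x y f
  proof -
    have "f \<bullet> x \<noteq> 1"
    proof
      assume 1: "f \<bullet> x = 1"
      obtain e where e: "e > 0" "cball x e \<subseteq> H"
        using D(1) x open_contains_cball by blast
      have "f \<noteq> 0"
        using 1 by auto
      have "x + (e / norm f) *\<^sub>R f \<in> closure H"
        using e \<open>f \<noteq> 0\<close>
        by (intro subsetD[OF closure_subset] subsetD[OF e(2)]) (simp add: dist_norm)
      then have "f \<bullet> (x + (e / norm f) *\<^sub>R f) \<le> 1"
        using yf S_iff by blast
      moreover have "f \<bullet> ((e / norm f) *\<^sub>R f) > 0"
        using e(1) \<open>f \<noteq> 0\<close> by simp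
      ultimately show False
        using 1 by (simp add: inner_add_right)
    qed
    moreover have "f \<bullet> x \<le> 1"
      using yf x closure_subset[of H] S_iff by blast
    ultimately show ?thesis
      by linarith
  qed
  have "H \<subseteq> K"
    using less_1 order.strict_trans2[OF _ b_ge] by (auto simp: K_def)
  have "frontier H - Q \<subseteq> K"
  proof
    fix x assume x: "x \<in> frontier H - Q"
    have "f \<bullet> x < b y" if yf: "(y, f) \<in> S" for y f
    proof (cases "x = y")
      case True
      have "infdist x Q > 0"
        using x Q(1,2) infdist_pos_not_in_closed by blast
      then show ?thesis
        using yf R(1) True by (simp add: b_def S_iff)
    next
      case False
      have "x \<in> closure H" "y \<in> closure H"
        using x yf fr S_iff by auto
      then have "(1/2) *\<^sub>R x + (1 - 1/2) *\<^sub>R y \<in> H"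
        using False by (intro strictly_convex_open_segment[OF H]) auto
      then have "f \<bullet> ((1/2) *\<^sub>R x + (1 - 1/2) *\<^sub>R y) < 1"
        using less_1 yf by blast
      then have "f \<bullet> x < 1"
        using yf by (simp add: S_iff inner_add_right)
      then show ?thesis
        using b_ge[of y] by linarith
    qed
    then show "x \<in> K"
      by (auto simp: K_def)
  qed
  \<comment> \<open>The support pair at the frontier point on the ray through \<open>x\<close>.\<close>
  have radial: "\<exists>y f. (y, f) \<in> S \<and> y = (1 / (f \<bullet> x)) *\<^sub>R x \<and> f \<bullet> x \<ge> 1" if x: "x \<notin> H" for x
  proof -
    have "x \<noteq> 0"
      using x D(4) by auto
    have "0 \<in> interior H"
      using D(1,4) by (simp add: interior_open)
    then obtain t where t: "t > 0" "0 + t *\<^sub>R x \<in> frontier H"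
      "\<And>e. 0 \<le> e \<Longrightarrow> e < t \<Longrightarrow> 0 + e *\<^sub>R x \<in> interior H"
      using ray_to_frontier[OF D(2) _ \<open>x \<noteq> 0\<close>] by blast
    have "t \<le> 1"
      using t(3)[of 1] x D(1) by (auto simp: interior_open not_le[symmetric])
    obtain f where f: "(t *\<^sub>R x, f) \<in> S"
      using support t(2) by auto
    then have "f \<bullet> x = 1 / t"
      using t(1) by (simp add: S_iff field_simps)
    then show ?thesis
      using f t(1) \<open>t \<le> 1\<close> by (intro exI[of _ "t *\<^sub>R x"] exI[of _ f]) simp
  qed
  have "K \<inter> Q = {}"
  proof -
    have False if x: "x \<in> K" "x \<in> Q" for x
    proof -
      have "x \<notin> H"
        using x(2) Q(4) by blast
      then obtain y f where yf: "(y, f) \<in> S" "y = (1 / (f \<bullet> x)) *\<^sub>R x" "f \<bullet> x \<ge> 1"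
        using radial by blast
      define c where "c = f \<bullet> x"
      have c: "c \<ge> 1" "x = c *\<^sub>R y"
        using yf(2,3) by (auto simp: c_def)
      have "infdist y Q \<le> dist y x"
        using x(2) by (rule infdist_le)
      also have "\<dots> = norm ((1 - c) *\<^sub>R y)"
        by (simp add: dist_norm c(2) scaleR_diff_left)
      also have "\<dots> = (c - 1) * norm y"
        using c(1) by simp
      also have "\<dots> \<le> (c - 1) * R"
        using R(2) fr yf(1) c(1) by (intro mult_left_mono) (auto simp: S_iff)
      finally have "b y \<le> c"
        using R(1) by (simp add: b_def field_simps)
      then show False
        using x(1) yf(1) by (auto simp: K_def c_def)
    qed
    then show ?thesis
      by blast
  qed
  have "bounded K"
  proof -
    obtain q where "q \<in> Q"
      using Q(2) by blast
    define B where "B = 1 + (R + norm q) / R"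
    have "norm x \<le> R + B * R" if x: "x \<in> K" for x
    proof (cases "x \<in> H")
      case True
      then have "norm x \<le> R"
        using R(2) closure_subset by blast
      moreover have "B * R \<ge> 0"
        using R(1) by (simp add: B_def)
      ultimately show ?thesis
        by linarith
    next
      case False
      then obtain y f where yf: "(y, f) \<in> S" "y = (1 / (f \<bullet> x)) *\<^sub>R x" "f \<bullet> x \<ge> 1"
        using radial by blast
      have y: "norm y \<le> R"
        using yf(1) R(2) fr by (simp add: S_iff)
      have "infdist y Q \<le> dist y q"
        using \<open>q \<in> Q\<close> by (rule infdist_le)
      also have "\<dots> \<le> R + norm q"
        using y norm_triangle_ineq4[of y q] by (simp add: dist_norm)
      finally have "b y \<le> B"
        using R(1) by (simp add: b_def B_def divide_right_mono)
      then have "f \<bullet> x \<le> B"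
        using x yf(1) by (force simp: K_def)
      have "x = (f \<bullet> x) *\<^sub>R y"
        using yf(2,3) by simp
      then have "norm x = (f \<bullet> x) * norm y"
        using yf(3) by (metis abs_of_nonneg norm_scaleR order_trans zero_le_one)
      also have "\<dots> \<le> B * R"
        using \<open>f \<bullet> x \<le> B\<close> yf(3) y by (intro mult_mono) auto
      finally show ?thesis
        using R(1) by simp
    qed
    then show ?thesis
      unfolding bounded_iff by blast
  qed
  have "convex K"
  proof -
    have "K = (\<Inter>z\<in>S. {x. snd z \<bullet> x < b (fst z)})"
      by (auto simp: K_def case_prod_unfold)
    then show ?thesis
      by (simp only:) (intro convex_INT convex_halfspace_lt)
  qed
  have Ssym: "(- y, - f) \<in> S" if yf: "(y, f) \<in> S" for y f
    using yf frontier_uminus[OF H(1)] D(6) by (force simp: S_iff)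
  have "b (- y) = b y" for y
  proof -
    have "infdist y Q \<le> infdist (- y) Q" for y
    proof -
      have "infdist y Q \<le> dist (- y) q" if "q \<in> Q" for q
      proof -
        have "dist y (- q) = dist (- y) q"
          by (metis dist_minus minus_minus)
        then show ?thesis
          using infdist_le[OF Q(3)[OF that], of y] by simp
      qed
      then show ?thesis
        using Q(2) by (simp add: infdist_notempty[of Q "- y"] cINF_greatest)
    qed
    from this[of y] this[of "- y"] show ?thesis
      by (simp add: b_def)
  qed
  then have Kneg: "- x \<in> K" if "x \<in> K" for x
    using that Ssym unfolding K_def by force
  then have "uminus ` K = K"
    by (force simp: image_iff)
  then have "symmetric_convex_domain K"
    unfolding symmetric_convex_domain_def
    using \<open>open K\<close> \<open>bounded K\<close> \<open>convex K\<close> \<open>H \<subseteq> K\<close> D(4) convex_connected by blast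
  then show ?thesis
    using that \<open>H \<subseteq> K\<close> \<open>K \<inter> Q = {}\<close> \<open>frontier H - Q \<subseteq> K\<close> by blast
qed

section \<open>Prescribing the critical locus\<close>

theorem theorem1p8:
  fixes H :: "(real^2) set" and Z :: "(real^2) set set"
  assumes "symmetric_convex_domain H"
    and "strictly_convex H"
    and "irreducible_domain H"
    and "Z \<noteq> {}"
    and "closedin (subtopology lattice_topology (critical_locus H)) Z"
  shows "\<exists>K. symmetric_convex_domain K \<and> H \<subseteq> K \<and> critical_locus K = Z"
proof -
  note H = assms(1,2)
  note D = symmetric_convex_domainD[OF H(1)]
  have Z: "critical H \<Lambda>" if "\<Lambda> \<in> Z" for \<Lambda>
    using that closedin_subset[OF assms(5)] by (auto simp: critical_locus_def)
  obtain \<Lambda>\<^sub>0 where \<Lambda>\<^sub>0: "\<Lambda>\<^sub>0 \<in> Z"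
    using assms(4) by blast
  obtain C where C: "compact C" "\<And>p q. (p, q) \<in> C \<Longrightarrow> cross2 p q \<noteq> 0"
    "Z = (\<lambda>(p, q). int_span p q) ` C"
    using closed_set_of_critical_lattices_compact[OF H Z[OF \<Lambda>\<^sub>0] assms(5)] by blast
  \<comment> \<open>Subtracting the open set \<open>H\<close> removes exactly the origin and keeps the set closed.\<close>
  define Q where "Q = \<Union>Z - H"
  have Z_H: "\<Lambda> \<inter> H = {0}" if "\<Lambda> \<in> Z" for \<Lambda>
    using Z[OF that] by (simp add: critical_def admissible_def)
  have "closed (\<Union>Z)"
    unfolding C(3) using closed_Union_int_span[OF C(1,2)] by (simp add: case_prod_unfold)
  then have "closed Q"
    unfolding Q_def using D(1) by (rule closed_Diff)
  moreover have "Q \<noteq> {}"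
    using critical_lattice_meets_frontier[OF H(1) Z[OF \<Lambda>\<^sub>0]] \<Lambda>\<^sub>0 D(7) by (auto simp: Q_def)
  moreover have "- x \<in> Q" if x: "x \<in> Q" for x
  proof -
    obtain p q where pq: "int_span p q \<in> Z" "x \<in> int_span p q"
      using x unfolding Q_def C(3) by auto
    obtain m n where "x = of_int m *\<^sub>R p + of_int n *\<^sub>R q"
      using pq(2) unfolding int_span_def by blast
    then have "- x \<in> int_span p q"
      by (intro int_spanI[of _ "- m" _ "- n"]) simp
    moreover have "- x \<notin> H"
      using x D(5)[of "- x"] by (auto simp: Q_def)
    ultimately show ?thesis
      using pq(1) by (auto simp: Q_def)
  qed
  moreover have "Q \<inter> H = {}"
    by (auto simp: Q_def)
  ultimately obtain K where K: "symmetric_convex_domain K" "H \<subseteq> K" "K \<inter> Q = {}" "frontier H - Q \<subseteq> K"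
    using enlarge_strictly_convex_domain[OF H] by metis
  have adm: "admissible H \<Lambda>" if "admissible K \<Lambda>" for \<Lambda>
    using that K(2) D(4) by (auto simp: admissible_def)
  have admZ: "admissible K \<Lambda>" if "\<Lambda> \<in> Z" for \<Lambda>
  proof -
    have "\<Lambda> \<inter> K \<subseteq> \<Lambda> \<inter> H"
      using that K(3) by (auto simp: Q_def)
    then show ?thesis
      using Z[OF that] K(2) by (auto simp: critical_def admissible_def)
  qed
  have "critical_determinant K = critical_determinant H"
  proof (rule antisym)
    show "critical_determinant K \<le> critical_determinant H"
      using critical_determinant_le[OF admZ[OF \<Lambda>\<^sub>0]] Z[OF \<Lambda>\<^sub>0] by (simp add: critical_def)
    show "critical_determinant H \<le> critical_determinant K"
      unfolding critical_determinant_def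
      using admZ[OF \<Lambda>\<^sub>0] adm by (intro cInf_superset_mono bdd_below_covolume) auto
  qed
  then have crit_iff: "critical K \<Lambda> \<longleftrightarrow> admissible K \<Lambda> \<and> critical H \<Lambda>" for \<Lambda>
    using adm by (auto simp: critical_def)
  have "\<Lambda> \<in> Z" if \<Lambda>: "critical K \<Lambda>" for \<Lambda>
  proof -
    have "critical H \<Lambda>"
      using \<Lambda> crit_iff by blast
    then obtain p where p: "p \<in> \<Lambda>" "p \<in> frontier H"
      using critical_lattice_meets_frontier[OF H(1)] by blast
    have "p \<notin> K"
    proof
      assume "p \<in> K"
      then have "p = 0"
        using p(1) \<Lambda> unfolding critical_def admissible_def by blast
      then show False
        using p(2) D(4,7) by blast
    qed
    then have "p \<in> Q"
      using K(4) p(2) by blast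
    then obtain \<Lambda>' where \<Lambda>': "\<Lambda>' \<in> Z" "p \<in> \<Lambda>'"
      by (auto simp: Q_def)
    obtain q where "\<And>\<Lambda>. critical H \<Lambda> \<Longrightarrow> p \<in> \<Lambda> \<Longrightarrow> \<Lambda> = int_span p q"
      using critical_lattice_through_frontier_point[OF H p(2)] by blast
    then have "\<Lambda> = \<Lambda>'"
      using \<open>critical H \<Lambda>\<close> p(1) Z \<Lambda>' by metis
    then show ?thesis
      using \<Lambda>'(1) by simp
  qed
  moreover have "critical K \<Lambda>" if "\<Lambda> \<in> Z" for \<Lambda>
    using crit_iff admZ[OF that] Z[OF that] by blast
  ultimately have "critical_locus K = Z"
    unfolding critical_locus_def by blast
  then show ?thesis
    using K(1,2) by blast
qed

end
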